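(* Let $(\mathbb S,+,\cdot,0,1)$ be a zero-sum free commutative semiring. The class of positive constraint-regular weighted tree languages over $\mathbb S$ is strictly more expressive than the class of weighted tree languages over $\mathbb S$ generated by eq-restricted, positive, and classic weighted tree grammars with constraints (WTGc); that is, every weighted tree language generated by an eq-restricted, positive, and classic WTGc over $\mathbb S$ is positive constraint-regular, and there exist a ranked alphabet $\Sigma$ and a positive constraint-regular weighted tree language $A\in\mathbb S^{T_\Sigma}$ that is not generated by any eq-restricted, positive, and classic WTGc over $\mathbb S$.
   Context: Trees: $\mathbb N=\{0,1,2,\dots\}$, $[k]=\{1,\dots,k\}$. A ranked alphabet $\Sigma$ is a finite set with a rank map $\mathrm{rk}\colon\Sigma\to\mathbb N$; $\Sigma_k=\mathrm{rk}^{-1}(k)$. $T_\Sigma(Z)$ is the smallest set containing $Z$ and $\sigma(t_1,\dots,t_k)$ for all $k\in\mathbb N$, $\sigma\in\Sigma_k$, $t_1,\dots,t_k\in T_\Sigma(Z)$; $T_\Sigma=T_\Sigma(\emptyset)$. Positions: $\mathrm{pos}(z)=\{\varepsilon\}$ for $z \in Z$ and $\mathrm{pos}(\sigma(t_1,\dots,t_k))=\{\varepsilon\}\cup\{iw\mid i\in[k],w\in\mathrm{pos}(t_i)\}$. $t(w)$, $t|_w$, $t[t']_w$ denote the label at $w$, the subtree at $w$, and the replacement of the subtree at $w$ by $t'$. $\mathrm{pos}_S(t)=\{w\in\mathrm{pos}(t)\mid t(w)\in S\}$. $X_k=\{x_1,\dots,x_k\}$ are variables; $c[t_1,\dots,t_k]$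 is substitution of $t_i$ for $x_i$. $\widehat C_\Sigma(X_k)$ is the set of $c\in T_\Sigma(X_k)$ in which each of $x_1,\dots,x_k$ occurs exactly once and in the order $x_1\cdots x_k$ from left to right. Commutative semiring: $(\mathbb S,+,0)$ and $(\mathbb S,\cdot,1)$ are commutative monoids, $\cdot$ distributes over $+$, and $0\cdot s=0$ for all $s\in\mathbb S$. It is zero-sum free if $s+s'=0$ implies $s=0=s'$. A weighted tree language over $\mathbb S$ is a map $A\colon T_\Sigma\to\mathbb S$. A WTGc over $\mathbb S$ is a tuple $G=(Q,\Sigma,F,P,\mathrm{wt})$ with a finite set $Q$ of nonterminals, final weights $F\in\mathbb S^Q$, a ranked alphabet $\Sigma$, a finite set $P$ of productions $(\ell,q,E,I)$, written $\ell\xrightarrow{E,I}q$, where $\ell\in T_\Sigma(Q)\setminus Q$, $q\in Q$, and $E,I\subseteq\mathbb N^*\times\mathbb N^*$ are finite (equality and inequality constraints), and $\mathrm{wt}\in\mathbb S^P$. A tree $t\in T_\Sigma$ satisfies $(v,v')$ if $v,v'\in\mathrm{pos}(t)$ and $t|_v=t|_{v'}$, otherwise it dissatisfies it. For $\xi,\zeta\in T_\Sigma(Q)$, $\xi\Rightarrow^{p,w}_{G,t}\zeta$ holds for $p=\ell\xrightarrow{E,I}q$ and $w\in\mathrm{pos}(\xi)$ if $\xi|_w=\ell$, $\zeta=\xi[q]_w$, $t|_w$ satisfies all pairs in $E$ and dissatisfies all pairs in $I$. $D^q_G(t)$ is the set of complete left-most derivations for $t$ to $q$, i.e. sequences $d=(p_1,w_1)\cdots(p_n,w_n)$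 with $t\Rightarrow^{p_1,w_1}_{G,t}\xi_1\Rightarrow\cdots\Rightarrow^{p_n,w_n}_{G,t}\xi_n=q$ and $w_1\prec\cdots\prec w_n$, where $\preceq$ is the lexicographic order on $\mathbb N^*$ in which prefixes are larger (so $\varepsilon$ is largest). $\mathrm{wt}_G(d)=\prod_i\mathrm{wt}(p_i)$. $G$ generates the weighted tree language $G_t=\sum_{q\in Q,\,d\in D_G^q(t)}F_q\cdot\mathrm{wt}_G(d)$. A production $\ell\xrightarrow{E,I}q$ is positive if $I=\emptyset$ and classic if $v,v'\in\mathrm{pos}_Q(\ell)$ for all $(v,v')\in E\cup I$. A WTGc is positive/classic if all its productions are. A weighted tree language is positive constraint-regular if it is generated by some positive WTGc. Eq-restricted: a nonterminal $\bot$ is a sink nonterminal if $F_\bot=0$ and the productions with target $\bot$ are exactly $\sigma(\bot,\dots,\bot)\to\bot$ (without constraints, weight $1$) for all $\sigma\in\Sigma$. Each production is uniquely written $c[q_1,\dots,q_k]\xrightarrow{E,I}q$ with $c\in\widehat C_\Sigma(X_k)$, $q_i\in Q$; let $c(E)=\{(i,j)\in[k]^2\mid (v,v')\in E,\ c(v)=x_i,\ c(v')=x_j\}$ and $\equiv_{c(E)}$ be the smallest equivalence relation on $[k]$ containing it. A classic WTGc is eq-restricted if there is a sink nonterminal $\bot\in Q$ such that for every production $c[q_1,\dots,q_k]\xrightarrow{E,I}q$ and every $i\in[k]$ there is $q'\in Q$ with (1) $\{q_j\mid j\in[i]_{\equiv_{c(E)}}\}\subseteq\{q',\bot\}$ and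 (2) exactly one $j\in[i]_{\equiv_{c(E)}}$ has $q_j=q'$.
   Formalization: The semiring is assumed to satisfy 0 ≠ 1: over the one-element semiring, which the definition allows and which is zero-sum free, each ranked alphabet has only one weighted tree language, generated by the grammar with only a sink, so strictness fails. *)

theory Defs
  imports Main
begin

section \<open>Trees\<close>

datatype ('f, 'z) tree = Var 'z | Fun 'f "('f, 'z) tree list"

text \<open>A ranked alphabet is a finite set of symbols with a rank map; the values of the rank map
  outside the set are irrelevant.\<close>

type_synonym 'f ranked_alphabet = "'f set \<times> ('f \<Rightarrow> nat)"

definition ranked_alphabet :: "'f ranked_alphabet \<Rightarrow> bool" where
  "ranked_alphabet \<Sigma> \<longleftrightarrow> finite (fst \<Sigma>)"

text \<open>\<open>trees \<Sigma> Z\<close> is the set of trees over \<open>\<Sigma>\<close> with leaves in \<open>Z\<close>.  The ground trees are \<open>trees \<Sigma> {}\<close>, so that they and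
  the sentential forms of a grammar live in the same type.\<close>

inductive_set trees :: "'f ranked_alphabet \<Rightarrow> 'z set \<Rightarrow> ('f, 'z) tree set"
  for \<Sigma> :: "'f ranked_alphabet" and Z :: "'z set" where
  Var: "z \<in> Z \<Longrightarrow> Var z \<in> trees \<Sigma> Z"
| Fun: "\<sigma> \<in> fst \<Sigma> \<Longrightarrow> length ts = snd \<Sigma> \<sigma> \<Longrightarrow> (\<And>t. t \<in> set ts \<Longrightarrow> t \<in> trees \<Sigma> Z) \<Longrightarrow>
    Fun \<sigma> ts \<in> trees \<Sigma> Z"

text \<open>Positions are 1-based, whereas \<open>!\<close> is 0-based.  The functions \<open>subtree_at\<close>, \<open>label\<close> and
  \<open>replace_at\<close> are meaningful only for positions of the given tree.\<close>

type_synonym position = "nat list"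

lemma size_nth_less [termination_simp]: "i < length ts \<Longrightarrow> size (ts ! i) < Suc (size_list size ts)"
  by (meson le_imp_less_Suc nth_mem order_refl size_list_estimation')

context
  notes conj_cong [fundef_cong]
begin

fun pos :: "('f, 'z) tree \<Rightarrow> position set" where
  "pos (Var z) = {[]}"
| "pos (Fun f ts) = {[]} \<union> {Suc i # w | i w. i < length ts \<and> w \<in> pos (ts ! i)}"

end

fun subtree_at :: "('f, 'z) tree \<Rightarrow> position \<Rightarrow> ('f, 'z) tree" where
  "subtree_at t [] = t"
| "subtree_at (Fun f ts) (i # w) = subtree_at (ts ! (i - 1)) w"

definition label :: "('f, 'z) tree \<Rightarrow> position \<Rightarrow> 'f + 'z" where
  "label t w = (case subtree_at t w of Var z \<Rightarrow> Inr z | Fun f ts \<Rightarrow> Inl f)"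

definition pos_of :: "('f + 'z) set \<Rightarrow> ('f, 'z) tree \<Rightarrow> position set" where
  "pos_of S t = {w \<in> pos t. label t w \<in> S}"

fun replace_at :: "('f, 'z) tree \<Rightarrow> position \<Rightarrow> ('f, 'z) tree \<Rightarrow> ('f, 'z) tree" where
  "replace_at t [] u = u"
| "replace_at (Fun f ts) (i # w) u = Fun f (ts[i - 1 := replace_at (ts ! (i - 1)) w u])"

text \<open>The variable $x_i$ is represented by its index \<open>i\<close>.\<close>

primrec subst :: "('f, 'z) tree list \<Rightarrow> ('f, nat) tree \<Rightarrow> ('f, 'z) tree" where
  "subst us (Var i) = us ! (i - 1)"
| "subst us (Fun f ts) = Fun f (map (subst us) ts)"

primrec leaf_word :: "('f, 'z) tree \<Rightarrow> 'z list" where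
  "leaf_word (Var z) = [z]"
| "leaf_word (Fun f ts) = concat (map leaf_word ts)"

definition contexts :: "'f ranked_alphabet \<Rightarrow> nat \<Rightarrow> ('f, nat) tree set" where
  "contexts \<Sigma> k = {c \<in> trees \<Sigma> {1..k}. leaf_word c = [1..<Suc k]}"

section \<open>Weighted tree grammars with constraints\<close>

type_synonym constr = "position \<times> position"

text \<open>A production consists of its left-hand side, its target nonterminal, its equality
  constraints, and its inequality constraints.\<close>

type_synonym ('f, 'q) production = "('f, 'q) tree \<times> 'q \<times> constr set \<times> constr set"

record ('f, 'q, 's) wtgc =
  nonterms :: "'q set"
  alphabet :: "'f ranked_alphabet"
  final :: "'q \<Rightarrow> 's"
  prods :: "('f, 'q) production set"
  wt :: "('f, 'q) production \<Rightarrow> 's"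

definition is_wtgc :: "('f, 'q, 's) wtgc \<Rightarrow> bool" where
  "is_wtgc G \<longleftrightarrow> finite (nonterms G) \<and> ranked_alphabet (alphabet G) \<and> finite (prods G) \<and>
    (\<forall>(l, q, E, I) \<in> prods G.
      l \<in> trees (alphabet G) (nonterms G) - Var ` nonterms G \<and> q \<in> nonterms G \<and>
      finite E \<and> finite I)"

definition satisfies :: "('f, 'z) tree \<Rightarrow> constr \<Rightarrow> bool" where
  "satisfies t = (\<lambda>(v, v'). v \<in> pos t \<and> v' \<in> pos t \<and> subtree_at t v = subtree_at t v')"

text \<open>The constraints are checked on the input tree \<open>t\<close> and not on the sentential form.\<close>

definition step ::
  "('f, 'q, 's) wtgc \<Rightarrow> ('f, 'q) tree \<Rightarrow> ('f, 'q) production \<Rightarrow> position \<Rightarrow>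
    ('f, 'q) tree \<Rightarrow> ('f, 'q) tree \<Rightarrow> bool" where
  "step G t = (\<lambda>(l, q, E, I) w \<xi> \<zeta>. (l, q, E, I) \<in> prods G \<and> w \<in> pos \<xi> \<and>
    subtree_at \<xi> w = l \<and> \<zeta> = replace_at \<xi> w (Var q) \<and>
    (\<forall>e \<in> E. satisfies (subtree_at t w) e) \<and> (\<forall>e \<in> I. \<not> satisfies (subtree_at t w) e))"

fun steps ::
  "('f, 'q, 's) wtgc \<Rightarrow> ('f, 'q) tree \<Rightarrow> (('f, 'q) production \<times> position) list \<Rightarrow>
    ('f, 'q) tree \<Rightarrow> ('f, 'q) tree \<Rightarrow> bool" where
  "steps G t [] \<xi> \<zeta> \<longleftrightarrow> \<xi> = \<zeta>"
| "steps G t ((p, w) # d) \<xi> \<zeta> \<longleftrightarrow> (\<exists>\<xi>'. step G t p w \<xi> \<xi>' \<and> steps G t d \<xi>' \<zeta>)"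

text \<open>The strict lexicographic order on positions in which proper prefixes are larger.\<close>

fun pos_less :: "position \<Rightarrow> position \<Rightarrow> bool" where
  "pos_less [] w \<longleftrightarrow> False"
| "pos_less (i # v) [] \<longleftrightarrow> True"
| "pos_less (i # v) (j # w) \<longleftrightarrow> i < j \<or> i = j \<and> pos_less v w"

definition derivations ::
  "('f, 'q, 's) wtgc \<Rightarrow> 'q \<Rightarrow> ('f, 'q) tree \<Rightarrow> (('f, 'q) production \<times> position) list set" where
  "derivations G q t = {d. steps G t d t (Var q) \<and> sorted_wrt pos_less (map snd d)}"

definition deriv_wt ::
  "('f, 'q, 's::comm_semiring_1) wtgc \<Rightarrow> (('f, 'q) production \<times> position) list \<Rightarrow> 's" where
  "deriv_wt G d = prod_list (map (\<lambda>(p, w). wt G p) d)"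

definition generated_weight ::
  "('f, 'q, 's::comm_semiring_1) wtgc \<Rightarrow> ('f, 'q) tree \<Rightarrow> 's" where
  "generated_weight G t = (\<Sum>q\<in>nonterms G. \<Sum>d\<in>derivations G q t. final G q * deriv_wt G d)"

text \<open>Class \<open>comm_semiring_1\<close> is that of commutative semirings with \<open>0 \<noteq> 1\<close>.  Over the one-element
  semiring there is only one weighted tree language for each ranked alphabet.\<close>

text \<open>The inner sum ranges over a finite set.\<close>

lemma finite_pos: "finite (pos t)"
proof (induction t)
  case (Fun f ts)
  have "pos (Fun f ts) \<subseteq> {[]} \<union> (\<Union>i<length ts. (#) (Suc i) ` pos (ts ! i))"
    by auto
  moreover have "finite \<dots>"
    using Fun by auto
  ultimately show ?case
    by (rule finite_subset)
qed simp

lemma pos_replace_at_Var: "w \<in> pos \<xi> \<Longrightarrow> pos (replace_at \<xi> w (Var q)) \<subseteq> pos \<xi>"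
proof (induction \<xi> arbitrary: w)
  case (Fun f ts)
  show ?case
  proof (cases w)
    case (Cons j v)
    with Fun.prems obtain i where i: "j = Suc i" "i < length ts" and v: "v \<in> pos (ts ! i)"
      by auto
    then have "pos (replace_at (ts ! i) v (Var q)) \<subseteq> pos (ts ! i)"
      using Fun.IH[of "ts ! i" v] by simp
    then show ?thesis
      using Cons i by (auto simp: nth_list_update split: if_splits)
  qed simp
qed simp

lemma finite_derivations:
  assumes "is_wtgc G"
  shows "finite (derivations G q t)"
proof -
  have fin: "finite (prods G \<times> pos t)"
    using assms by (simp add: is_wtgc_def finite_pos)
  have steps: "set d \<subseteq> prods G \<times> pos \<xi>" if "steps G t d \<xi> \<zeta>" for d \<xi> \<zeta>
    using that
  proof (induction d arbitrary: \<xi>)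
    case (Cons pw d)
    obtain p w where pw: "pw = (p, w)" by fastforce
    with Cons.prems obtain \<xi>' where st: "step G t p w \<xi> \<xi>'" and d: "steps G t d \<xi>' \<zeta>"
      by auto
    from st have "p \<in> prods G" "w \<in> pos \<xi>" "pos \<xi>' \<subseteq> pos \<xi>"
      using pos_replace_at_Var[of w \<xi>] by (auto simp: step_def split: prod.splits)
    with Cons.IH[OF d] pw show ?case by auto
  qed simp
  have irrefl: "\<not> pos_less w w" for w
    by (induction w) auto
  have dist: "distinct ws" if "sorted_wrt pos_less ws" for ws
    using that irrefl by (induction ws) auto
  have "derivations G q t \<subseteq> {d. set d \<subseteq> prods G \<times> pos t \<and> length d \<le> card (prods G \<times> pos t)}"
  proof
    fix d assume "d \<in> derivations G q t"
    then have "steps G t d t (Var q)" and "distinct (map snd d)"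
      using dist by (auto simp: derivations_def)
    then have sub: "set d \<subseteq> prods G \<times> pos t" and "distinct d"
      using steps by (blast, simp add: distinct_map)
    then show "d \<in> {d. set d \<subseteq> prods G \<times> pos t \<and> length d \<le> card (prods G \<times> pos t)}"
      using card_mono[OF fin sub] by (simp add: distinct_card)
  qed
  then show ?thesis
    using finite_lists_length_le[OF fin] finite_subset by blast
qed

section \<open>Classes of grammars\<close>

definition positive :: "('f, 'q, 's) wtgc \<Rightarrow> bool" where
  "positive G \<longleftrightarrow> (\<forall>(l, q, E, I) \<in> prods G. I = {})"

definition classic :: "('f, 'q, 's) wtgc \<Rightarrow> bool" where
  "classic G \<longleftrightarrow> (\<forall>(l, q, E, I) \<in> prods G. \<forall>(v, v') \<in> E \<union> I.
    v \<in> pos_of (Inr ` nonterms G) l \<and> v' \<in> pos_of (Inr ` nonterms G) l)"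

definition sink :: "('f, 'q, 's::comm_semiring_1) wtgc \<Rightarrow> 'q \<Rightarrow> bool" where
  "sink G b \<longleftrightarrow> b \<in> nonterms G \<and> final G b = 0 \<and>
    {(l, q, E, I) \<in> prods G. q = b} =
      (\<lambda>\<sigma>. (Fun \<sigma> (replicate (snd (alphabet G) \<sigma>) (Var b)), b, {}, {})) ` fst (alphabet G) \<and>
    (\<forall>(l, q, E, I) \<in> prods G. q = b \<longrightarrow> wt G (l, q, E, I) = 1)"

definition constr_indices :: "nat \<Rightarrow> ('f, nat) tree \<Rightarrow> constr set \<Rightarrow> (nat \<times> nat) set" where
  "constr_indices k c E = {(i, j) \<in> {1..k} \<times> {1..k}. \<exists>(v, v') \<in> E.
    v \<in> pos c \<and> v' \<in> pos c \<and> label c v = Inr i \<and> label c v' = Inr j}"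

definition constr_equiv :: "nat \<Rightarrow> ('f, nat) tree \<Rightarrow> constr set \<Rightarrow> (nat \<times> nat) set" where
  "constr_equiv k c E = \<Inter>{r. equiv {1..k} r \<and> constr_indices k c E \<subseteq> r}"

text \<open>The decomposition of a left-hand side as \<open>c[q\<^sub>1,\<dots>,q\<^sub>k]\<close> is unique, so quantifying over all
  decompositions is the same as choosing one.\<close>

definition eq_restricted :: "('f, 'q, 's::comm_semiring_1) wtgc \<Rightarrow> bool" where
  "eq_restricted G \<longleftrightarrow> (\<exists>b. sink G b \<and>
    (\<forall>(l, q, E, I) \<in> prods G. \<forall>k. \<forall>c \<in> contexts (alphabet G) k. \<forall>qs.
      length qs = k \<and> set qs \<subseteq> nonterms G \<and> l = subst (map Var qs) c \<longrightarrow>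
      (\<forall>i \<in> {1..k}. \<exists>q' \<in> nonterms G.
        {qs ! (j - 1) | j. j \<in> constr_equiv k c E `` {i}} \<subseteq> {q', b} \<and>
        (\<exists>!j. j \<in> constr_equiv k c E `` {i} \<and> qs ! (j - 1) = q'))))"

section \<open>Classes of weighted tree languages\<close>

text \<open>A weighted tree language over \<open>\<Sigma>\<close> is a function whose values outside \<open>trees \<Sigma> {}\<close> are
  ignored.\<close>

definition generates ::
  "('f, 'q, 's::comm_semiring_1) wtgc \<Rightarrow> 'f ranked_alphabet \<Rightarrow> (('f, 'q) tree \<Rightarrow> 's) \<Rightarrow> bool" where
  "generates G \<Sigma> A \<longleftrightarrow> is_wtgc G \<and> alphabet G = \<Sigma> \<and>
    (\<forall>t \<in> trees \<Sigma> {}. generated_weight G t = A t)"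

text \<open>The nonterminals form an arbitrary finite set, which can be taken to be a set of natural
  numbers because renaming nonterminals does not change the generated weighted tree language.\<close>

definition positive_constraint_regular ::
  "'f ranked_alphabet \<Rightarrow> (('f, nat) tree \<Rightarrow> 's::comm_semiring_1) \<Rightarrow> bool" where
  "positive_constraint_regular \<Sigma> A \<longleftrightarrow>
    (\<exists>G :: ('f, nat, 's) wtgc. generates G \<Sigma> A \<and> positive G)"

definition eq_restricted_positive_classic_regular ::
  "'f ranked_alphabet \<Rightarrow> (('f, nat) tree \<Rightarrow> 's::comm_semiring_1) \<Rightarrow> bool" where
  "eq_restricted_positive_classic_regular \<Sigma> A \<longleftrightarrow>
    (\<exists>G :: ('f, nat, 's) wtgc. generates G \<Sigma> A \<and> eq_restricted G \<and> positive G \<and> classic G)"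

end

theory Submission
  imports Defs
begin

text \<open>A maximal proper ideal closed under summands yields a homomorphism from a zero-sum free
  semiring to the Booleans, so only derivations whose weights avoid this ideal matter.
  The separating language consists of the trees \<open>T\<^sub>0 = \<beta>\<close> and \<open>T\<^bsub>n+1\<^esub> = \<sigma>(T\<^sub>n, \<gamma>\<^sup>n(\<alpha>))\<close>,
  which are recognised by comparing the positions \<open>12\<close> and \<open>21\<close>.
  For a positive classic grammar, two of these trees, \<open>T\<^sub>n\<close> and \<open>T\<^sub>m\<close>, are derived with the
  same last production.  Of the subtrees of \<open>T\<^sub>n\<close> at the nonterminals of its left-hand side,
  replace those of the form \<open>T\<^sub>i\<close> by the corresponding subtrees of \<open>T\<^sub>m\<close>.  Equal subtrees are
  treated equally, so all constraints still hold, but the new tree is outside the language.\<close>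

section \<open>Homomorphisms to the Booleans\<close>

text \<open>\<open>N\<close> is the preimage of \<open>True\<close> under a semiring homomorphism to
  the Booleans with disjunction and conjunction.\<close>

definition bool_hom :: "'s::comm_semiring_1 set \<Rightarrow> bool" where
  "bool_hom N \<longleftrightarrow> 0 \<notin> N \<and> 1 \<in> N \<and> (\<forall>a b. a + b \<in> N \<longleftrightarrow> a \<in> N \<or> b \<in> N) \<and>
    (\<forall>a b. a * b \<in> N \<longleftrightarrow> a \<in> N \<and> b \<in> N)"

text \<open>Zorn's lemma applies because zero-sum freeness makes \<open>{0}\<close> closed under
  summands. A maximal \<open>J\<close> is prime, so its complement is multiplicative.\<close>

lemma ex_bool_hom:
  assumes zsf: "\<And>a b :: 's::comm_semiring_1. a + b = 0 \<Longrightarrow> a = 0 \<and> b = 0"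
  shows "\<exists>N :: 's set. bool_hom N"
proof -
  \<comment> \<open>The equivalence for sums, rather than mere closure, becomes the additive law of
    the complement.\<close>
  define ideal where "ideal J \<longleftrightarrow> 0 \<in> J \<and> 1 \<notin> J \<and> (\<forall>a b. a + b \<in> J \<longleftrightarrow> a \<in> J \<and> b \<in> J) \<and>
    (\<forall>a b. a \<in> J \<longrightarrow> a * b \<in> J)" for J :: "'s set"
  have "a + b = 0 \<longleftrightarrow> a = 0 \<and> b = 0" for a b :: 's
    using zsf[of a b] by auto
  then have "ideal {0}"
    by (simp add: ideal_def)
  have "\<exists>J\<in>{J. ideal J}. \<forall>K\<in>{J. ideal J}. J \<subseteq> K \<longrightarrow> K = J"
  proof (rule subset_Zorn)
    fix C assume "subset.chain {J. ideal J} C"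
    then have C: "\<And>J. J \<in> C \<Longrightarrow> ideal J" "\<And>J K. J \<in> C \<Longrightarrow> K \<in> C \<Longrightarrow> J \<subseteq> K \<or> K \<subseteq> J"
      by (auto simp: subset_chain_def)
    show "\<exists>U\<in>{J. ideal J}. \<forall>J\<in>C. J \<subseteq> U"
    proof (cases "C = {}")
      case True
      with \<open>ideal {0}\<close> show ?thesis by blast
    next
      case False
      have add: "a + b \<in> \<Union>C \<longleftrightarrow> a \<in> \<Union>C \<and> b \<in> \<Union>C" for a b
      proof
        assume "a + b \<in> \<Union>C"
        then obtain J where "J \<in> C" "a + b \<in> J" by blast
        with C(1) show "a \<in> \<Union>C \<and> b \<in> \<Union>C"
          by (auto simp: ideal_def)
      next
        assume "a \<in> \<Union>C \<and> b \<in> \<Union>C"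
        then obtain J where "J \<in> C" "a \<in> J" "b \<in> J"
          using C(2) by blast
        with C(1) show "a + b \<in> \<Union>C"
          by (auto simp: ideal_def)
      qed
      have "a * b \<in> \<Union>C" if "a \<in> \<Union>C" for a b
        using that C(1) by (meson UnionE UnionI ideal_def)
      moreover have "0 \<in> \<Union>C" "1 \<notin> \<Union>C"
        using C(1) False by (auto simp: ideal_def)
      ultimately have "ideal (\<Union>C)"
        using add by (simp add: ideal_def)
      then show ?thesis by blast
    qed
  qed
  then obtain J where J: "ideal J" and max: "\<And>K. ideal K \<Longrightarrow> J \<subseteq> K \<Longrightarrow> K = J"
    by blast
  have prime: "a \<in> J \<or> b \<in> J" if ab: "a * b \<in> J" for a b
  proof (rule ccontr)
    assume n: "\<not> (a \<in> J \<or> b \<in> J)"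
    \<comment> \<open>This is the colon ideal of \<open>J\<close> by \<open>b\<close>. It is proper
      since \<open>1 * b\<close> is outside \<open>J\<close>, so maximality makes it equal to
      \<open>J\<close>, yet it contains \<open>a\<close>.\<close>
    let ?K = "{x. x * b \<in> J}"
    have "x * y * b \<in> J" if "x * b \<in> J" for x y
    proof -
      have "x * b * y \<in> J"
        using J that by (simp add: ideal_def)
      then show ?thesis
        by (simp add: ac_simps)
    qed
    then have "ideal ?K"
      using J n unfolding ideal_def by (simp add: distrib_right)
    moreover have "J \<subseteq> ?K"
      using J by (auto simp: ideal_def)
    ultimately have "?K = J"
      by (rule max)
    with ab n show False by blast
  qed
  have "a * b \<in> J \<longleftrightarrow> a \<in> J \<or> b \<in> J" for a b
    using J prime[of a b] by (metis ideal_def mult.commute)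
  then have "bool_hom (- J)"
    using J by (simp add: ideal_def bool_hom_def)
  then show ?thesis by blast
qed

lemma bool_hom_sum:
  assumes "bool_hom N"
  shows "finite A \<Longrightarrow> sum f A \<in> N \<longleftrightarrow> (\<exists>x\<in>A. f x \<in> N)"
  by (induction A rule: finite_induct) (use assms in \<open>auto simp: bool_hom_def\<close>)

lemma bool_hom_prod_list:
  "bool_hom N \<Longrightarrow> prod_list xs \<in> N \<longleftrightarrow> set xs \<subseteq> N"
  by (induction xs) (auto simp: bool_hom_def)

section \<open>Derivability\<close>

text \<open>\<open>covers G N \<xi> t\<close> means that \<open>\<xi>\<close> is obtained from \<open>t\<close> by replacing subtrees by nonterminals
  that derive them using productions with weights in \<open>N\<close>.\<close>

inductive covers ::
  "('f, 'q, 's) wtgc \<Rightarrow> 's set \<Rightarrow> ('f, 'q) tree \<Rightarrow> ('f, 'q) tree \<Rightarrow> bool"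
  for G N where
  Fun: "list_all2 (covers G N) ls ts \<Longrightarrow> covers G N (Fun f ls) (Fun f ts)"
| Var: "(l, q, E, I) \<in> prods G \<Longrightarrow> wt G (l, q, E, I) \<in> N \<Longrightarrow> covers G N l t \<Longrightarrow>
    \<forall>e\<in>E. satisfies t e \<Longrightarrow> \<forall>e\<in>I. \<not> satisfies t e \<Longrightarrow> covers G N (Var q) t"

inductive_cases covers_FunE: "covers G N (Fun f ls) t"
inductive_cases covers_VarE: "covers G N (Var q) t"

lemma covers_refl: "t \<in> trees \<Sigma> {} \<Longrightarrow> covers G N t t"
  by (induction rule: trees.induct) (auto intro!: covers.Fun list.rel_refl_strong)

text \<open>Every nonterminal is eventually expanded by left-hand sides over the alphabet. This
  later places the mixed tree among the ground trees.\<close>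

lemma covers_trees:
  assumes "is_wtgc G"
  shows "covers G N \<xi> t \<Longrightarrow> \<xi> \<in> trees (alphabet G) (nonterms G) \<Longrightarrow> t \<in> trees (alphabet G) {}"
proof (induction rule: covers.induct)
  case (Fun ls ts f)
  from Fun.prems show ?case
  proof (cases rule: trees.cases)
    case Fun': (Fun)
    show ?thesis
    proof (rule trees.Fun)
      show "length ts = snd (alphabet G) f"
        using Fun Fun' by (auto dest: list_all2_lengthD)
      show "t \<in> trees (alphabet G) {}" if t: "t \<in> set ts" for t
      proof -
        obtain i where i: "i < length ts" "t = ts ! i"
          using t by (auto simp: in_set_conv_nth)
        moreover have "ls ! i \<in> trees (alphabet G) (nonterms G)"
          using Fun' i \<open>length ts = snd (alphabet G) f\<close> by auto
        ultimately show ?thesis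
          using Fun.IH by (auto simp: list_all2_conv_all_nth)
      qed
    qed (use Fun' in simp)
  qed
next
  case (Var l q E I t)
  then have "l \<in> trees (alphabet G) (nonterms G)"
    using assms by (fastforce simp: is_wtgc_def)
  with Var.IH show ?case .
qed

lemma Nil_in_pos [simp]: "[] \<in> pos t"
  by (cases t) auto

lemma covers_subtree:
  "covers G N \<xi> t \<Longrightarrow> w \<in> pos \<xi> \<Longrightarrow>
    w \<in> pos t \<and> covers G N (subtree_at \<xi> w) (subtree_at t w)"
proof (induction \<xi> arbitrary: t w)
  case (Fun f ls)
  show ?case
  proof (cases w)
    case (Cons j v)
    with Fun.prems obtain i where i: "j = Suc i" "i < length ls" "v \<in> pos (ls ! i)"
      by auto
    from Fun.prems obtain ts where ts: "t = Fun f ts" "list_all2 (covers G N) ls ts"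
      by (auto elim: covers_FunE)
    have "v \<in> pos (ts ! i) \<and> covers G N (subtree_at (ls ! i) v) (subtree_at (ts ! i) v)"
      using Fun.IH[of "ls ! i" "ts ! i" v] ts i by (simp add: list_all2_conv_all_nth)
    then show ?thesis
      using ts Cons i by (auto dest: list_all2_lengthD)
  next
    case Nil
    then show ?thesis
      using Fun.prems by (cases t) auto
  qed
next
  case (Var q)
  then show ?case by (cases t) auto
qed

lemma covers_replace:
  "covers G N \<xi> t \<Longrightarrow> w \<in> pos \<xi> \<Longrightarrow> covers G N \<zeta> (subtree_at t w) \<Longrightarrow>
    covers G N (replace_at \<xi> w \<zeta>) t"
proof (induction \<xi> arbitrary: t w)
  case (Fun f ls)
  show ?case
  proof (cases w)
    case (Cons j v)
    with Fun.prems obtain i where i: "j = Suc i" "i < length ls" "v \<in> pos (ls ! i)"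
      by auto
    from Fun.prems obtain ts where ts: "t = Fun f ts" "list_all2 (covers G N) ls ts"
      by (auto elim: covers_FunE)
    have "covers G N (replace_at (ls ! i) v \<zeta>) (ts ! i)"
      using Fun.IH[of "ls ! i" "ts ! i" v] Fun.prems ts i Cons by (simp add: list_all2_conv_all_nth)
    then show ?thesis
      using ts Cons i by (auto intro!: covers.Fun simp: list_all2_conv_all_nth nth_list_update)
  qed (use Fun.prems in simp)
qed simp

text \<open>Covering is an invariant of derivation steps: a left-hand side found at \<open>w\<close>
  covers the input subtree at \<open>w\<close>, hence so does the nonterminal replacing it.\<close>

lemma steps_covers:
  "steps G t d \<xi> \<zeta> \<Longrightarrow> covers G N \<xi> t \<Longrightarrow> \<forall>(p, w) \<in> set d. wt G p \<in> N \<Longrightarrow> covers G N \<zeta> t"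
proof (induction d arbitrary: \<xi>)
  case (Cons pw d)
  obtain l q E I w where pw: "pw = ((l, q, E, I), w)"
    by (metis prod.exhaust)
  with Cons.prems obtain \<xi>' where s: "step G t (l, q, E, I) w \<xi> \<xi>'" and d: "steps G t d \<xi>' \<zeta>"
    by auto
  have "covers G N l (subtree_at t w)"
    using covers_subtree[OF Cons.prems(2), of w] s by (auto simp: step_def)
  then have "covers G N (Var q) (subtree_at t w)"
    using s pw Cons.prems(3) by (auto simp: step_def intro: covers.Var)
  then have "covers G N \<xi>' t"
    using covers_replace[OF Cons.prems(2)] s by (auto simp: step_def)
  with Cons.IH d Cons.prems(3) show ?case by auto
qed simp

section \<open>From coverings to left-most derivations\<close>

lemma steps_append:
  "steps G t d \<xi> \<zeta> \<Longrightarrow> steps G t e \<zeta> \<chi> \<Longrightarrow> steps G t (d @ e) \<xi> \<chi>"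
  by (induction G t d \<xi> \<zeta> rule: steps.induct) auto

text \<open>Constraints survive the shift because they are checked on the input subtree, which is
  the same seen from the child or from the root. The list \<open>xs\<close> holds the current state
  of the siblings.\<close>

lemma steps_in_child:
  assumes "i < length ts" "length xs = length ts"
  shows "steps G (ts ! i) d \<xi> \<zeta> \<Longrightarrow>
    steps G (Fun f ts) (map (\<lambda>(p, w). (p, Suc i # w)) d) (Fun f (xs[i := \<xi>])) (Fun f (xs[i := \<zeta>]))"
proof (induction d arbitrary: \<xi>)
  case (Cons pw d)
  obtain p w where pw: "pw = (p, w)" by fastforce
  with Cons.prems obtain \<xi>' where s: "step G (ts ! i) p w \<xi> \<xi>'" and d: "steps G (ts ! i) d \<xi>' \<zeta>"
    by auto
  have "step G (Fun f ts) p (Suc i # w) (Fun f (xs[i := \<xi>])) (Fun f (xs[i := \<xi>']))"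
    using s assms by (auto simp: step_def split: prod.splits)
  with Cons.IH[OF d] pw show ?case by auto
qed simp

lemma sorted_wrt_pos_less_Cons:
  "sorted_wrt pos_less (map ((#) i) ws) \<longleftrightarrow> sorted_wrt pos_less ws"
  by (simp add: sorted_wrt_map)

text \<open>Derivations of the children are concatenated from left to right and a root production
  comes last, which is the required order. The final conjunct keeps the root position free for that
  production.\<close>

lemma covers_steps:
  assumes G: "is_wtgc G"
  shows "covers G N \<xi> t \<Longrightarrow>
    \<exists>d. steps G t d t \<xi> \<and> sorted_wrt pos_less (map snd d) \<and> (\<forall>(p, w) \<in> set d. wt G p \<in> N) \<and>
      (\<forall>f ls. \<xi> = Fun f ls \<longrightarrow> [] \<notin> snd ` set d)"
proof (induction rule: covers.induct)
  case (Fun ls ts f)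
  then have len: "length ls = length ts"
    by (auto dest: list_all2_lengthD)
  \<comment> \<open>The first \<open>k\<close> children are already reduced and the others are still
    input; \<open>k\<close> grows to the full length.\<close>
  have "\<exists>d. steps G (Fun f ts) d (Fun f ts) (Fun f (take k ls @ drop k ts)) \<and>
      sorted_wrt pos_less (map snd d) \<and> (\<forall>(p, w) \<in> set d. wt G p \<in> N) \<and>
      (\<forall>w \<in> snd ` set d. \<exists>i v. w = Suc i # v \<and> i < k)"
    if "k \<le> length ts" for k
    using that
  proof (induction k)
    case 0
    then show ?case by (intro exI[of _ "[]"]) simp
  next
    case (Suc k)
    let ?xs = "take k ls @ drop k ts"
    from Suc obtain d where d: "steps G (Fun f ts) d (Fun f ts) (Fun f ?xs)"
        "sorted_wrt pos_less (map snd d)" "\<forall>(p, w) \<in> set d. wt G p \<in> N"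
        "\<forall>w \<in> snd ` set d. \<exists>i v. w = Suc i # v \<and> i < k"
      by auto
    have k: "k < length ts" using Suc by simp
    with Fun obtain e where e: "steps G (ts ! k) e (ts ! k) (ls ! k)"
        "sorted_wrt pos_less (map snd e)" "\<forall>(p, w) \<in> set e. wt G p \<in> N"
      by (blast dest: list_all2_nthD2)
    let ?e = "map (\<lambda>(p, w). (p, Suc k # w)) e"
    have upd: "?xs[k := x] = take k ls @ x # drop (Suc k) ts" for x
      using k len by (simp add: list_update_append Cons_nth_drop_Suc[symmetric])
    have "?xs[k := ts ! k] = ?xs"
      using k by (simp add: upd Cons_nth_drop_Suc)
    moreover have "?xs[k := ls ! k] = take (Suc k) ls @ drop (Suc k) ts"
      using k len by (simp add: upd take_Suc_conv_app_nth)
    ultimately have "steps G (Fun f ts) (d @ ?e) (Fun f ts) (Fun f (take (Suc k) ls @ drop (Suc k) ts))"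
      using steps_append[OF d(1)] steps_in_child[OF k _ e(1), of ?xs f] k len by (simp only: length_append) simp
    moreover have "sorted_wrt pos_less (map snd (d @ ?e))"
    proof -
      have "map snd ?e = map ((#) (Suc k)) (map snd e)"
        by auto
      then have "sorted_wrt pos_less (map snd ?e)"
        using e(2) by (simp only: sorted_wrt_pos_less_Cons)
      moreover have "pos_less v w" if v: "v \<in> snd ` set d" and w: "w \<in> snd ` set ?e" for v w
      proof -
        obtain i v' where "v = Suc i # v'" "i < k"
          using d(4) v by blast
        moreover obtain w' where "w = Suc k # w'"
          using w by auto
        ultimately show ?thesis by simp
      qed
      ultimately show ?thesis
        using d(2) by (simp only: map_append sorted_wrt_append list.set_map) blast
    qed
    moreover have "\<forall>(p, w) \<in> set (d @ ?e). wt G p \<in> N"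
      using d(3) e(3) by auto
    moreover have "\<forall>w \<in> snd ` set (d @ ?e). \<exists>i v. w = Suc i # v \<and> i < Suc k"
    proof
      fix w assume "w \<in> snd ` set (d @ ?e)"
      then consider "w \<in> snd ` set d" | "w \<in> snd ` set ?e"
        unfolding set_append image_Un by blast
      then show "\<exists>i v. w = Suc i # v \<and> i < Suc k"
      proof cases
        case 1
        then show ?thesis
          using d(4) less_SucI by blast
      qed auto
    qed
    ultimately show ?case by blast
  qed
  from this[of "length ts"] len
  show ?case by (simp only: order_refl take_all drop_all append_Nil2) blast
next
  case (Var l q E I t)
  then obtain d where d: "steps G t d t l" "sorted_wrt pos_less (map snd d)"
      "\<forall>(p, w) \<in> set d. wt G p \<in> N" "\<forall>f ls. l = Fun f ls \<longrightarrow> [] \<notin> snd ` set d"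
    by blast
  \<comment> \<open>Left-hand sides are never single nonterminals, so the derivation of
    \<open>l\<close> avoids the root and all its positions precede \<open>[]\<close>.\<close>
  have "l \<in> trees (alphabet G) (nonterms G) - Var ` nonterms G"
    using G Var.hyps(1) by (auto simp: is_wtgc_def)
  then obtain f ls where "l = Fun f ls"
    by (auto elim: trees.cases)
  with d(4) have ne: "[] \<notin> snd ` set d" by blast
  have "steps G t [((l, q, E, I), [])] l (Var q)"
    using Var.hyps by (auto simp: step_def)
  moreover have "pos_less w []" if "w \<in> snd ` set d" for w
    using ne that by (cases w) auto
  ultimately show ?case
    using d(2,3) Var.hyps(2) steps_append[OF d(1)]
    by (intro exI[of _ "d @ [((l, q, E, I), [])]"]) (auto simp: sorted_wrt_append)
qed

text \<open>The homomorphism turns the sum of products into existence of a derivation with all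
  factors in \<open>N\<close>, so multiplicities of derivations disappear.\<close>

lemma generated_weight_in_bool_hom:
  assumes G: "is_wtgc G" and N: "bool_hom N" and t: "t \<in> trees \<Sigma> {}"
  shows "generated_weight G t \<in> N \<longleftrightarrow> (\<exists>q\<in>nonterms G. final G q \<in> N \<and> covers G N (Var q) t)"
proof -
  have wt: "deriv_wt G d \<in> N \<longleftrightarrow> (\<forall>(p, w) \<in> set d. wt G p \<in> N)" for d
    by (auto simp: deriv_wt_def bool_hom_prod_list[OF N])
  have deriv: "(\<exists>d\<in>derivations G q t. deriv_wt G d \<in> N) \<longleftrightarrow> covers G N (Var q) t" for q
  proof
    assume "\<exists>d\<in>derivations G q t. deriv_wt G d \<in> N"
    then obtain d where "steps G t d t (Var q)" "\<forall>(p, w) \<in> set d. wt G p \<in> N"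
      unfolding wt derivations_def by blast
    then show "covers G N (Var q) t"
      using steps_covers covers_refl[OF t] by blast
  next
    assume "covers G N (Var q) t"
    from covers_steps[OF G this] show "\<exists>d\<in>derivations G q t. deriv_wt G d \<in> N"
      unfolding wt derivations_def by blast
  qed
  have mult: "a * b \<in> N \<longleftrightarrow> a \<in> N \<and> b \<in> N" for a b
    using N by (simp add: bool_hom_def)
  have "finite (nonterms G)"
    using G by (simp add: is_wtgc_def)
  then have "generated_weight G t \<in> N \<longleftrightarrow>
      (\<exists>q\<in>nonterms G. \<exists>d\<in>derivations G q t. final G q * deriv_wt G d \<in> N)"
    by (simp add: generated_weight_def bool_hom_sum[OF N] finite_derivations[OF G])
  also have "\<dots> \<longleftrightarrow> (\<exists>q\<in>nonterms G. final G q \<in> N \<and> covers G N (Var q) t)"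
    unfolding mult deriv[symmetric] by blast
  finally show ?thesis .
qed

section \<open>Mixing trees below a left-hand side\<close>

text \<open>The choice at a nonterminal leaf depends only on the subtree of \<open>a\<close> there.
  The last equation is a default that does not arise when \<open>l\<close> covers both
  trees.\<close>

fun mix :: "('f, 'q) tree set \<Rightarrow> ('f, 'q) tree \<Rightarrow> ('f, 'q) tree \<Rightarrow> ('f, 'q) tree \<Rightarrow> ('f, 'q) tree" where
  "mix S (Var q) a b = (if a \<in> S then b else a)"
| "mix S (Fun f ls) (Fun g as) (Fun h bs) =
    Fun f (map (\<lambda>i. mix S (ls ! i) (as ! i) (bs ! i)) [0..<length ls])"
| "mix S (Fun f ls) a b = a"

lemma covers_mix:
  "covers G N l a \<Longrightarrow> covers G N l b \<Longrightarrow> covers G N l (mix S l a b)"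
proof (induction S l a b rule: mix.induct)
  case (2 S f ls g as h bs)
  then show ?case
    by (auto elim!: covers_FunE intro!: covers.Fun simp: list_all2_conv_all_nth)
qed (auto elim: covers_FunE)

lemma subtree_at_mix:
  assumes "covers G N l a" "covers G N l b" "v \<in> pos l" "subtree_at l v = Var q"
  shows "v \<in> pos (mix S l a b) \<and>
    subtree_at (mix S l a b) v = (if subtree_at a v \<in> S then subtree_at b v else subtree_at a v)"
  using assms
proof (induction S l a b arbitrary: v rule: mix.induct)
  case (1 S q' a b)
  then show ?case
    by (cases "mix S (Var q') a b") auto
next
  case (2 S f ls g as h bs)
  from 2(2,3) have l: "list_all2 (covers G N) ls as" "list_all2 (covers G N) ls bs"
    by (auto elim!: covers_FunE)
  from 2(4,5) obtain i w where v: "v = Suc i # w" "i < length ls" "w \<in> pos (ls ! i)"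
      "subtree_at (ls ! i) w = Var q"
    by auto
  with 2(1)[of i w] l show ?case
    by (auto simp: list_all2_conv_all_nth)
qed (auto elim: covers_FunE)

text \<open>Classic constraints compare nonterminal positions of \<open>l\<close>. Two such
  positions with equal subtrees in \<open>a\<close> receive the same choice, and equality in
  \<open>a\<close> and in \<open>b\<close> gives equality in the mixture. Positivity leaves no
  inequality to violate.\<close>

lemma covers_Var_mix:
  assumes "positive G" "classic G" "(l, q, E, I) \<in> prods G" "wt G (l, q, E, I) \<in> N"
    and a: "covers G N l a" "\<forall>e\<in>E. satisfies a e"
    and b: "covers G N l b" "\<forall>e\<in>E. satisfies b e"
  shows "covers G N (Var q) (mix S l a b)"
proof (rule covers.Var)
  show "covers G N l (mix S l a b)"
    using a b by (simp add: covers_mix)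
  show "\<forall>e\<in>E. satisfies (mix S l a b) e"
  proof clarify
    fix v v' assume e: "(v, v') \<in> E"
    then have "v \<in> pos_of (range Inr) l" "v' \<in> pos_of (range Inr) l"
      using assms(2,3) by (fastforce simp: classic_def pos_of_def)+
    then obtain p p' where "v \<in> pos l" "subtree_at l v = Var p" "v' \<in> pos l" "subtree_at l v' = Var p'"
      by (auto simp: pos_of_def label_def split: tree.splits)
    then show "satisfies (mix S l a b) (v, v')"
      using subtree_at_mix[OF a(1) b(1), where S = S] a(2) b(2) e
      by (fastforce simp: satisfies_def)
  qed
  show "\<forall>e\<in>I. \<not> satisfies (mix S l a b) e"
    using assms(1,3) by (auto simp: positive_def)
qed (use assms in auto)

section \<open>The separating language\<close>

text \<open>The symbols \<open>\<alpha>\<close>, \<open>\<beta>\<close>, \<open>\<gamma>\<close>, \<open>\<sigma>\<close> are represented by \<open>0\<close>, \<open>1\<close>, \<open>2\<close>, \<open>3\<close>.\<close>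

definition sig :: "nat ranked_alphabet" where
  "sig = ({0, 1, 2, 3}, \<lambda>f. f - 1)"

primrec chain :: "nat \<Rightarrow> (nat, 'q) tree" where
  "chain 0 = Fun 0 []"
| "chain (Suc n) = Fun 2 [chain n]"

primrec comb :: "nat \<Rightarrow> (nat, 'q) tree" where
  "comb 0 = Fun 1 []"
| "comb (Suc n) = Fun 3 [comb n, chain n]"

lemma chain_inject [simp]: "chain n = chain m \<longleftrightarrow> n = m"
proof (induction n arbitrary: m)
  case 0
  show ?case by (cases m) auto
next
  case (Suc n)
  then show ?case by (cases m) auto
qed

lemma comb_inject [simp]: "comb n = comb m \<longleftrightarrow> n = m"
  by (cases n; cases m) auto

lemma chain_notin_range_comb: "(chain n :: (nat, 'q) tree) \<notin> range comb"
proof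
  assume "(chain n :: (nat, 'q) tree) \<in> range comb"
  then obtain m where "(chain n :: (nat, 'q) tree) = comb m" by blast
  then show False
    by (cases n; cases m) auto
qed

lemma chain_in_trees: "chain n \<in> trees sig {}"
  by (induction n) (auto intro!: trees.Fun simp: sig_def)

lemma comb_in_trees: "comb n \<in> trees sig {}"
proof (induction n)
  case (Suc n)
  then show ?case
    using chain_in_trees[of n] by (auto intro!: trees.Fun simp: sig_def)
qed (auto intro!: trees.Fun simp: sig_def)

section \<open>Mixing chains and combs\<close>

text \<open>All subtrees of a chain are chains, hence never combs, so nothing is exchanged.\<close>

lemma mix_chain:
  "covers G N l (chain n) \<Longrightarrow> covers G N l (chain m) \<Longrightarrow>
    mix (range comb) l (chain n) (chain m) = chain n"
proof (induction n arbitrary: l m)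
  case 0
  show ?case
  proof (cases l)
    case (Var q)
    then show ?thesis
      by (simp add: chain_notin_range_comb del: chain.simps)
  next
    case (Fun f ls)
    with 0 show ?thesis
      by (cases m) (auto elim!: covers_FunE)
  qed
next
  case (Suc n)
  show ?case
  proof (cases l)
    case (Var q)
    then show ?thesis
      by (simp add: chain_notin_range_comb del: chain.simps)
  next
    case (Fun f ls)
    with Suc show ?thesis
      by (cases m) (auto elim!: covers_FunE simp: list_all2_Cons2)
  qed
qed

text \<open>The right child of the root keeps the chain of the first comb, so a comb could arise
  only if the left child stayed as it was. But that child either is exchanged for a different comb
  or, by induction, is no comb at all. In the base case the root labels clash.\<close>

lemma mix_comb_notin:
  assumes "n \<noteq> m" "covers G N (Fun f ls) (comb n)" "covers G N (Fun f ls) (comb m)"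
  shows "mix (range comb) (Fun f ls) (comb n) (comb m) \<notin> range comb"
  using assms
proof (induction n arbitrary: f ls m)
  case 0
  then show ?case
    by (cases m) (auto elim!: covers_FunE)
next
  case (Suc n)
  then obtain m' where m: "m = Suc m'"
    by (cases m) (auto elim!: covers_FunE)
  with Suc.prems obtain l l' where ls: "ls = [l, l']" and f: "f = 3"
      and l: "covers G N l (comb n)" "covers G N l (comb m')"
      and l': "covers G N l' (chain n)" "covers G N l' (chain m')"
    by (auto elim!: covers_FunE simp: list_all2_Cons2)
  have "mix (range comb) l (comb n) (comb m') \<noteq> comb n"
  proof (cases l)
    case (Var q)
    with Suc.prems m show ?thesis by auto
  next
    case (Fun g ks)
    with Suc.IH[of m' g ks] Suc.prems m l show ?thesis by auto
  qed
  moreover have "mix (range comb) (Fun f ls) (comb (Suc n)) (comb m) =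
      Fun 3 [mix (range comb) l (comb n) (comb m'), chain n]"
    using mix_chain[OF l'] by (simp add: ls f m)
  ultimately show ?case
  proof safe
    fix k
    assume "mix (range comb) (Fun f ls) (comb (Suc n)) (comb m) = comb k"
      and *: "mix (range comb) l (comb n) (comb m') \<noteq> comb n"
      and "mix (range comb) (Fun f ls) (comb (Suc n)) (comb m) =
        Fun 3 [mix (range comb) l (comb n) (comb m'), chain n]"
    then have "Fun 3 [mix (range comb) l (comb n) (comb m'), chain n] = comb k" by simp
    with * show False by (cases k) auto
  qed
qed

section \<open>No positive classic grammar has the combs as its support\<close>

lemma positive_classic_not_comb:
  fixes G :: "(nat, 'q, 's::comm_semiring_1) wtgc"
  assumes G: "is_wtgc G" and pc: "positive G" "classic G" and alph: "alphabet G = sig"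
    and N: "bool_hom N"
    and comb: "\<And>t. t \<in> trees sig {} \<Longrightarrow> generated_weight G t \<in> N \<longleftrightarrow> t \<in> range comb"
  shows False
proof -
  let ?comb = "comb :: nat \<Rightarrow> (nat, 'q) tree"
  note gen = generated_weight_in_bool_hom[OF G N]
  \<comment> \<open>For a production \<open>p\<close> of \<open>G\<close>, this says that
    \<open>p\<close> can come last in a derivation of \<open>comb n\<close> that contributes a
    weight in \<open>N\<close>. Positivity leaves no inequality constraints to record.\<close>
  define accepts where "accepts n p \<longleftrightarrow> (case p of (l, q, E, I) \<Rightarrow> q \<in> nonterms G \<and>
      final G q \<in> N \<and> wt G p \<in> N \<and> covers G N l (?comb n) \<and>
      (\<forall>e\<in>E. satisfies (?comb n) e))" for n p
  have "\<exists>p. p \<in> prods G \<and> accepts n p" for n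
  proof -
    obtain q where q: "q \<in> nonterms G" "final G q \<in> N" "covers G N (Var q) (?comb n)"
      using comb[OF comb_in_trees[of n]] gen[OF comb_in_trees[of n]] by blast
    from q(3) show ?thesis
    proof (rule covers_VarE)
      fix l E I
      assume "(l, q, E, I) \<in> prods G" "wt G (l, q, E, I) \<in> N" "covers G N l (?comb n)"
        "\<forall>e\<in>E. satisfies (?comb n) e"
      with q(1,2) show ?thesis
        by (intro exI[of _ "(l, q, E, I)"]) (simp add: accepts_def)
    qed
  qed
  then obtain p where p: "\<And>n. p n \<in> prods G" "\<And>n. accepts n (p n)"
    by metis
  \<comment> \<open>Pigeonhole: infinitely many combs share finitely many last productions.\<close>
  have "finite (range p)"
    using G p(1) by (auto simp: is_wtgc_def intro: finite_subset[of _ "prods G"])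
  then have "\<not> inj p"
    using finite_imageD by blast
  then obtain n m where nm: "n \<noteq> m" "p n = p m"
    by (auto simp: inj_def)
  obtain l q E I where lq: "p n = (l, q, E, I)"
    by (metis prod.exhaust)
  have n: "q \<in> nonterms G" "final G q \<in> N" "wt G (l, q, E, I) \<in> N"
      "covers G N l (?comb n)" "\<forall>e\<in>E. satisfies (?comb n) e"
    using p(2)[of n] lq by (simp_all add: accepts_def)
  have m: "covers G N l (?comb m)" "\<forall>e\<in>E. satisfies (?comb m) e"
    using p(2)[of m] lq nm(2) by (simp_all add: accepts_def)
  have prod: "(l, q, E, I) \<in> prods G"
    using p(1)[of n] lq by simp
  then have "l \<in> trees (alphabet G) (nonterms G) - Var ` nonterms G"
    using G by (auto simp: is_wtgc_def)
  then obtain f ls where l: "l = Fun f ls"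
    by (auto elim: trees.cases)
  let ?t = "mix (range ?comb) l (?comb n) (?comb m)"
  have t: "covers G N (Var q) ?t"
    by (rule covers_Var_mix[OF pc prod n(3,4,5) m])
  have "?t \<in> trees sig {}"
    using covers_trees[OF G t] n(1) alph by (auto intro: trees.Var)
  then have "?t \<in> range ?comb"
    using comb gen t n(1,2) by blast
  with mix_comb_notin[OF nm(1), of G N f ls] n(4) m(1) l show False
    by simp
qed

section \<open>A positive grammar for the combs with a non-classic constraint\<close>

text \<open>The nonterminals \<open>0\<close> and \<open>1\<close> derive chains and combs.\<close>

definition comb_prods :: "(nat, nat) production set" where
  "comb_prods =
    {(Fun 0 [], 0, {}, {}), (Fun 2 [Var 0], 0, {}, {}),
     (Fun 1 [], 1, {}, {}), (Fun 3 [Fun 1 [], Fun 0 []], 1, {}, {}),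
     (Fun 3 [Var 1, Var 0], 1, {([1, 2], [2, 1])}, {})}"

text \<open>The final weight \<open>of_nat q\<close> is 0 for the chain nonterminal and 1 for the
  comb nonterminal.\<close>

definition comb_wtgc :: "(nat, nat, 's::comm_semiring_1) wtgc" where
  "comb_wtgc = \<lparr>nonterms = {0, 1}, alphabet = sig, final = (\<lambda>q. of_nat q),
    prods = comb_prods, wt = (\<lambda>_. 1)\<rparr>"

lemma is_wtgc_comb: "is_wtgc comb_wtgc"
  by (auto simp: is_wtgc_def comb_wtgc_def comb_prods_def sig_def ranked_alphabet_def
      intro!: trees.intros)

lemma positive_comb: "positive comb_wtgc"
  by (auto simp: positive_def comb_wtgc_def comb_prods_def)

lemma covers_comb_wtgc_VarD:
  assumes "covers comb_wtgc N (Var q) t"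
  shows "\<exists>l E. (l, q, E, {}) \<in> comb_prods \<and> covers comb_wtgc N l t \<and> (\<forall>e\<in>E. satisfies t e)"
  using assms
proof (rule covers_VarE)
  fix l E I
  assume p: "(l, q, E, I) \<in> prods comb_wtgc" and "covers comb_wtgc N l t" "\<forall>e\<in>E. satisfies t e"
  moreover have "(l, q, E, I) \<in> comb_prods" "I = {}"
    using p by (auto simp: comb_wtgc_def comb_prods_def)
  ultimately show ?thesis by blast
qed

lemma covers_comb_wtgc_0D:
  "covers comb_wtgc N (Var 0) t \<Longrightarrow> t \<in> range chain"
proof (induction t)
  case (Fun f ts)
  from covers_comb_wtgc_VarD[OF Fun.prems]
  consider "f = 0" "ts = []" | u where "f = 2" "ts = [u]" "covers comb_wtgc N (Var 0) u"
    by (auto simp: comb_prods_def list_all2_Cons1 elim!: covers_FunE)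
  then show ?case
  proof cases
    case 1
    then have "Fun f ts = chain 0" by simp
    then show ?thesis by blast
  next
    case 2
    then obtain n where "u = chain n"
      using Fun.IH[of u] by auto
    with 2 have "Fun f ts = chain (Suc n)" by simp
    then show ?thesis by blast
  qed
next
  case (Var q)
  from covers_comb_wtgc_VarD[OF this] show ?case
    by (auto simp: comb_prods_def elim!: covers_FunE)
qed

lemma covers_comb_wtgc_1D:
  "covers comb_wtgc N (Var 1) t \<Longrightarrow> t \<in> range comb"
proof (induction t)
  case (Fun f ts)
  from covers_comb_wtgc_VarD[OF Fun.prems]
  consider "f = 1" "ts = []" | "f = 3" "ts = [Fun 1 [], Fun 0 []]" |
    u v where "f = 3" "ts = [u, v]" "covers comb_wtgc N (Var 1) u" "covers comb_wtgc N (Var 0) v"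
      "satisfies (Fun f ts) ([1, 2], [2, 1])"
    by (auto simp: comb_prods_def list_all2_Cons1 elim!: covers_FunE)
  then show ?case
  proof cases
    case 1
    then have "Fun f ts = comb 0" by simp
    then show ?thesis by blast
  next
    case 2
    then have "Fun f ts = comb 1" by simp
    then show ?thesis by blast
  next
    case 3
    obtain k where k: "u = comb k"
      using Fun.IH[of u] 3 by auto
    obtain j where j: "v = chain j"
      using covers_comb_wtgc_0D[OF 3(4)] by auto
    \<comment> \<open>Position 12 exists only for \<open>k = Suc k'\<close> and holds
      \<open>chain k'\<close>; position 21 exists only for \<open>j = Suc j'\<close> and holds
      \<open>chain j'\<close>. The constraint therefore forces \<open>j = k\<close>.\<close>
    from 3 k j have "Fun f ts = comb (Suc k)"
      by (cases k; cases j) (auto simp: satisfies_def)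
    then show ?thesis by blast
  qed
next
  case (Var q)
  from covers_comb_wtgc_VarD[OF this] show ?case
    by (auto simp: comb_prods_def elim!: covers_FunE)
qed

lemma covers_comb_wtgc_0:
  assumes "bool_hom N"
  shows "covers comb_wtgc N (Var 0) (chain n)"
proof (induction n)
  case 0
  show ?case
    by (rule covers.Var[of "Fun 0 []" _ "{}" "{}"])
       (use assms in \<open>auto simp: bool_hom_def comb_wtgc_def comb_prods_def intro: covers.Fun\<close>)
next
  case (Suc n)
  then show ?case
    by (intro covers.Var[of "Fun 2 [Var 0]" _ "{}" "{}"])
       (use assms in \<open>auto simp: bool_hom_def comb_wtgc_def comb_prods_def intro: covers.Fun\<close>)
qed

lemma covers_comb_wtgc_1:
  assumes "bool_hom N"
  shows "covers comb_wtgc N (Var 1) (comb n)"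
proof (induction n)
  case 0
  show ?case
    by (rule covers.Var[of "Fun 1 []" _ "{}" "{}"])
       (use assms in \<open>auto simp: bool_hom_def comb_wtgc_def comb_prods_def intro: covers.Fun\<close>)
next
  case (Suc n)
  show ?case
  proof (cases n)
    \<comment> \<open>The tree \<open>comb 1\<close> lacks the compared positions, so it has its own
      production without constraints.\<close>
    case 0
    then show ?thesis
      by (intro covers.Var[of "Fun 3 [Fun 1 [], Fun 0 []]" _ "{}" "{}"])
         (use assms in \<open>auto simp: bool_hom_def comb_wtgc_def comb_prods_def intro: covers.Fun\<close>)
  next
    case (Suc k)
    then have "satisfies (comb (Suc n)) ([1, 2], [2, 1])"
      by (auto simp: satisfies_def)
    moreover have "covers comb_wtgc N (Fun 3 [Var 1, Var 0]) (comb (Suc n))"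
      using \<open>covers comb_wtgc N (Var 1) (comb n)\<close> covers_comb_wtgc_0[OF assms] by (auto intro: covers.Fun)
    ultimately show ?thesis
      by (intro covers.Var[of "Fun 3 [Var 1, Var 0]" _ "{([1, 2], [2, 1])}" "{}"])
         (use assms in \<open>auto simp: bool_hom_def comb_wtgc_def comb_prods_def\<close>)
  qed
qed

lemma generated_weight_comb_wtgc:
  assumes N: "bool_hom N" and t: "t \<in> trees sig {}"
  shows "generated_weight comb_wtgc t \<in> N \<longleftrightarrow> t \<in> range comb"
  using generated_weight_in_bool_hom[OF is_wtgc_comb N t] N
    covers_comb_wtgc_1D[of N t] covers_comb_wtgc_1[OF N]
  by (auto simp: comb_wtgc_def bool_hom_def)

theorem proposition2:
  assumes zero_sum_free:
    "\<And>a b :: 's::comm_semiring_1. a + b = 0 \<Longrightarrow> a = 0 \<and> b = 0"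
  shows
    "(\<forall>(\<Sigma> :: 'f ranked_alphabet) (A :: ('f, nat) tree \<Rightarrow> 's).
        ranked_alphabet \<Sigma> \<longrightarrow> eq_restricted_positive_classic_regular \<Sigma> A \<longrightarrow>
        positive_constraint_regular \<Sigma> A) \<and>
     (\<exists>(\<Sigma> :: nat ranked_alphabet) (A :: (nat, nat) tree \<Rightarrow> 's).
        ranked_alphabet \<Sigma> \<and> positive_constraint_regular \<Sigma> A \<and>
        \<not> eq_restricted_positive_classic_regular \<Sigma> A)"
proof (intro conjI allI impI exI)
  fix \<Sigma> :: "'f ranked_alphabet" and A :: "('f, nat) tree \<Rightarrow> 's"
  assume "eq_restricted_positive_classic_regular \<Sigma> A"
  then show "positive_constraint_regular \<Sigma> A"
    by (auto simp: eq_restricted_positive_classic_regular_def positive_constraint_regular_def)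
next
  show "ranked_alphabet sig"
    by (simp add: ranked_alphabet_def sig_def)
  \<comment> \<open>The language is whatever \<open>comb_wtgc\<close> generates, so its positive
    regularity is immediate. Its exact weights need not be computed: membership in \<open>N\<close>
    suffices for the separation.\<close>
  let ?A = "generated_weight comb_wtgc :: (nat, nat) tree \<Rightarrow> 's"
  have "alphabet comb_wtgc = sig"
    by (simp add: comb_wtgc_def)
  then show "positive_constraint_regular sig ?A"
    using is_wtgc_comb positive_comb
    by (auto simp: positive_constraint_regular_def generates_def)
  obtain N :: "'s set" where N: "bool_hom N"
    using ex_bool_hom[OF zero_sum_free] by blast
  show "\<not> eq_restricted_positive_classic_regular sig ?A"
  proof
    assume "eq_restricted_positive_classic_regular sig ?A"
    then obtain G :: "(nat, nat, 's) wtgc" where G: "generates G sig ?A" "positive G" "classic G"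
      by (auto simp: eq_restricted_positive_classic_regular_def)
    then show False
      using positive_classic_not_comb[OF _ G(2,3) _ N] generated_weight_comb_wtgc[OF N]
      by (auto simp: generates_def)
  qed
qed

end
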